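(* Let $\Gamma$ be a group which acts freely on a set $\Gamma'$. Let $R$ be a $\Gamma$-graded division ring and $M$ be a $\Gamma'$-graded module over $R$. Then any two homogeneous bases of $M$ over $R$ have the same cardinality.
   Context: $\Gamma$ is an arbitrary (multiplicative, not necessarily abelian) group. A left action of $\Gamma$ on $\Gamma'$ is free if $\gamma\delta=\gamma'\delta$ for $\gamma,\gamma'\in\Gamma$, $\delta\in\Gamma'$ implies $\gamma=\gamma'$. A $\Gamma$-graded ring is $R=\bigoplus_{\gamma\in\Gamma}R_\gamma$ with additive subgroups satisfying $R_\gamma R_\delta\subseteq R_{\gamma\delta}$; it is a graded division ring if every non-zero homogeneous element (element of some $R_\gamma$) has a multiplicative inverse. A $\Gamma'$-graded (left) $R$-module is a left $R$-module $M=\bigoplus_{\lambda\in\Gamma'}M_\lambda$ with additive subgroups $M_\lambda$ satisfying $R_\gamma M_\lambda\subseteq M_{\gamma\lambda}$. A homogeneous basis of $M$ is an $R$-basis consisting of homogeneous elements (elements of $\bigcup_\lambda M_\lambda$). *)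

theory Defs
  imports
    "HOL-Algebra.Group_Action"
    "HOL-Algebra.AbelCoset"
    "HOL-Algebra.Module"
    "HOL-Library.Equipollence"
begin

text \<open>Library group actions are left actions: \<open>\<phi>\<close> is a homomorphism into the group of bijections
  of \<open>E\<close> under composition.\<close>

locale free_action = group_action +
  assumes free: "\<lbrakk>g \<in> carrier G; h \<in> carrier G; x \<in> E; \<phi> g x = \<phi> h x\<rbrakk> \<Longrightarrow> g = h"

text \<open>The library's locale \<open>module\<close> requires a commutative ring of scalars. Here the ring need not
  be commutative; the axioms are otherwise the same. The multiplicative fields of the record \<open>M\<close>
  play no role.\<close>

locale left_module = R?: ring R + M?: abelian_group M
  for R :: "('r, 'p) ring_scheme" and M :: "('r, 'm, 'q) module_scheme" +
  assumes smult_closed [simp, intro]: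
      "\<lbrakk>a \<in> carrier R; x \<in> carrier M\<rbrakk> \<Longrightarrow> a \<odot>\<^bsub>M\<^esub> x \<in> carrier M"
    and smult_l_distr:
      "\<lbrakk>a \<in> carrier R; b \<in> carrier R; x \<in> carrier M\<rbrakk> \<Longrightarrow>
        (a \<oplus>\<^bsub>R\<^esub> b) \<odot>\<^bsub>M\<^esub> x = a \<odot>\<^bsub>M\<^esub> x \<oplus>\<^bsub>M\<^esub> b \<odot>\<^bsub>M\<^esub> x"
    and smult_r_distr:
      "\<lbrakk>a \<in> carrier R; x \<in> carrier M; y \<in> carrier M\<rbrakk> \<Longrightarrow>
        a \<odot>\<^bsub>M\<^esub> (x \<oplus>\<^bsub>M\<^esub> y) = a \<odot>\<^bsub>M\<^esub> x \<oplus>\<^bsub>M\<^esub> a \<odot>\<^bsub>M\<^esub> y"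
    and smult_assoc:
      "\<lbrakk>a \<in> carrier R; b \<in> carrier R; x \<in> carrier M\<rbrakk> \<Longrightarrow>
        (a \<otimes>\<^bsub>R\<^esub> b) \<odot>\<^bsub>M\<^esub> x = a \<odot>\<^bsub>M\<^esub> (b \<odot>\<^bsub>M\<^esub> x)"
    and smult_one [simp]: "x \<in> carrier M \<Longrightarrow> \<one>\<^bsub>R\<^esub> \<odot>\<^bsub>M\<^esub> x = x"

text \<open>\<open>M\<close> is the internal direct sum of the additive subgroups \<open>N i\<close>, \<open>i \<in> I\<close>: every element is
  in exactly one way the sum of a finitely supported family. Extensionality (\<open>\<Pi>\<^sub>E\<close>) fixes the
  values outside \<open>I\<close>, as uniqueness requires.\<close>

definition internal_direct_sum ::
  "('a, 'm) ring_scheme \<Rightarrow> 'i set \<Rightarrow> ('i \<Rightarrow> 'a set) \<Rightarrow> bool" where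
  "internal_direct_sum M I N \<longleftrightarrow>
     (\<forall>i\<in>I. additive_subgroup (N i) M) \<and>
     (\<forall>x\<in>carrier M. \<exists>!f. f \<in> (\<Pi>\<^sub>E i\<in>I. N i) \<and> finite {i\<in>I. f i \<noteq> \<zero>\<^bsub>M\<^esub>} \<and>
        x = (\<Oplus>\<^bsub>M\<^esub>i\<in>{i\<in>I. f i \<noteq> \<zero>\<^bsub>M\<^esub>}. f i))"

locale graded_ring = \<Gamma>?: group \<Gamma> + R?: ring R
  for \<Gamma> :: "('g, 'k) monoid_scheme" and R :: "('r, 'p) ring_scheme" +
  fixes Rg :: "'g \<Rightarrow> 'r set"
  assumes ring_direct_sum: "internal_direct_sum R (carrier \<Gamma>) Rg"
    and ring_graded_mult:
      "\<lbrakk>\<gamma> \<in> carrier \<Gamma>; \<delta> \<in> carrier \<Gamma>; a \<in> Rg \<gamma>; b \<in> Rg \<delta>\<rbrakk> \<Longrightarrow> a \<otimes>\<^bsub>R\<^esub> b \<in> Rg (\<gamma> \<otimes>\<^bsub>\<Gamma>\<^esub> \<delta>)"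

text \<open>As usual for division rings, the zero ring is excluded. Over the zero ring the zero module has
  both the empty set and \<open>{\<zero>}\<close> as bases.\<close>

locale graded_division_ring = graded_ring +
  assumes one_not_zero: "\<one>\<^bsub>R\<^esub> \<noteq> \<zero>\<^bsub>R\<^esub>"
    and homogeneous_invertible:
      "\<lbrakk>\<gamma> \<in> carrier \<Gamma>; a \<in> Rg \<gamma>; a \<noteq> \<zero>\<^bsub>R\<^esub>\<rbrakk> \<Longrightarrow> a \<in> Units R"

locale graded_module =
  graded_ring \<Gamma> R Rg + left_module R M + group_action \<Gamma> \<Gamma>' \<phi>
  for \<Gamma> :: "('g, 'k) monoid_scheme" and R :: "('r, 'p) ring_scheme" and Rg :: "'g \<Rightarrow> 'r set"
    and \<Gamma>' :: "'l set" and \<phi> :: "'g \<Rightarrow> 'l \<Rightarrow> 'l" and M :: "('r, 'm, 'q) module_scheme" +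
  fixes Mg :: "'l \<Rightarrow> 'm set"
  assumes module_direct_sum: "internal_direct_sum M \<Gamma>' Mg"
    and module_graded_smult:
      "\<lbrakk>\<gamma> \<in> carrier \<Gamma>; l \<in> \<Gamma>'; a \<in> Rg \<gamma>; x \<in> Mg l\<rbrakk> \<Longrightarrow> a \<odot>\<^bsub>M\<^esub> x \<in> Mg (\<phi> \<gamma> l)"

definition lin_independent ::
  "('r, 'p) ring_scheme \<Rightarrow> ('r, 'm, 'q) module_scheme \<Rightarrow> 'm set \<Rightarrow> bool" where
  "lin_independent R M B \<longleftrightarrow>
     (\<forall>A c. finite A \<and> A \<subseteq> B \<and> c \<in> A \<rightarrow> carrier R \<and> (\<Oplus>\<^bsub>M\<^esub>b\<in>A. c b \<odot>\<^bsub>M\<^esub> b) = \<zero>\<^bsub>M\<^esub>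
        \<longrightarrow> (\<forall>b\<in>A. c b = \<zero>\<^bsub>R\<^esub>))"

definition spanning ::
  "('r, 'p) ring_scheme \<Rightarrow> ('r, 'm, 'q) module_scheme \<Rightarrow> 'm set \<Rightarrow> bool" where
  "spanning R M B \<longleftrightarrow>
     (\<forall>x\<in>carrier M. \<exists>A c. finite A \<and> A \<subseteq> B \<and> c \<in> A \<rightarrow> carrier R \<and>
        x = (\<Oplus>\<^bsub>M\<^esub>b\<in>A. c b \<odot>\<^bsub>M\<^esub> b))"

definition module_basis ::
  "('r, 'p) ring_scheme \<Rightarrow> ('r, 'm, 'q) module_scheme \<Rightarrow> 'm set \<Rightarrow> bool" where
  "module_basis R M B \<longleftrightarrow> B \<subseteq> carrier M \<and> lin_independent R M B \<and> spanning R M B"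

definition homogeneous_basis ::
  "('r, 'p) ring_scheme \<Rightarrow> 'l set \<Rightarrow> ('r, 'm, 'q) module_scheme \<Rightarrow> ('l \<Rightarrow> 'm set) \<Rightarrow> 'm set \<Rightarrow> bool"
  where
  "homogeneous_basis R \<Gamma>' M Mg B \<longleftrightarrow> module_basis R M B \<and> B \<subseteq> (\<Union>l\<in>\<Gamma>'. Mg l)"

end

theory Submission
  imports Defs
begin

text \<open>The homogeneous elements of \<open>M\<close> form a (possibly infinite) matroid under linear span. The
  point is the exchange property: if a homogeneous \<open>x\<close> of degree \<open>\<mu>\<close> is a combination of
  \<open>y\<close>, homogeneous of degree \<open>\<lambda>\<close>, and of a set \<open>S\<close> of homogeneous elements, then projecting
  to degree \<open>\<mu>\<close> leaves of the coefficient of \<open>y\<close> only its component of the degree \<open>\<gamma>\<close> with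
  \<open>\<gamma>\<lambda> = \<mu>\<close>. As the action is free there is at most one such \<open>\<gamma>\<close>, so the new coefficient is
  homogeneous, hence zero or invertible.\<close>

section \<open>Bases of finitary matroids\<close>

locale finitary_matroid =
  fixes E :: "'a set" and cl :: "'a set \<Rightarrow> 'a set"
  assumes subset_cl: "S \<subseteq> E \<Longrightarrow> S \<subseteq> cl S"
    and cl_least: "\<lbrakk>S \<subseteq> E; T \<subseteq> cl S\<rbrakk> \<Longrightarrow> cl T \<subseteq> cl S"
    and finitary: "\<lbrakk>S \<subseteq> E; x \<in> cl S\<rbrakk> \<Longrightarrow> \<exists>F. finite F \<and> F \<subseteq> S \<and> x \<in> cl F"
    and exchange: "\<lbrakk>S \<subseteq> E; x \<in> E; y \<in> E; x \<in> cl (insert y S); x \<notin> cl S\<rbrakk> \<Longrightarrow> y \<in> cl (insert x S)"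
begin

definition indep :: "'a set \<Rightarrow> bool" where
  "indep B \<longleftrightarrow> B \<subseteq> E \<and> (\<forall>b\<in>B. b \<notin> cl (B - {b}))"

lemma cl_mono: "\<lbrakk>S \<subseteq> T; T \<subseteq> E\<rbrakk> \<Longrightarrow> cl S \<subseteq> cl T"
  using cl_least subset_cl by (meson order_trans)

lemma indep_subset:
  assumes "indep B" "A \<subseteq> B"
  shows "indep A"
proof -
  have "cl (A - {a}) \<subseteq> cl (B - {a})" for a
    using assms by (intro cl_mono) (auto simp: indep_def)
  with assms show ?thesis
    unfolding indep_def by blast
qed

text \<open>If some \<open>b\<close> in \<open>B\<close> became dependent on \<open>x\<close> and
  the rest of \<open>B\<close>, exchange would put \<open>x\<close> into the closure of
  \<open>B\<close>.\<close>

lemma indep_insert: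
  assumes B: "indep B" and x: "x \<in> E" "x \<notin> cl B"
  shows "indep (insert x B)"
proof -
  have BE: "B \<subseteq> E" using B by (simp add: indep_def)
  then have "x \<notin> B" using x subset_cl by blast
  have "b \<notin> cl (insert x B - {b})" if b: "b \<in> B" for b
  proof
    assume "b \<in> cl (insert x B - {b})"
    moreover have "insert x B - {b} = insert x (B - {b})"
      using b \<open>x \<notin> B\<close> by auto
    moreover have "b \<notin> cl (B - {b})" using B b by (simp add: indep_def)
    ultimately have "x \<in> cl (insert b (B - {b}))"
      using exchange[of "B - {b}" b x] BE b x by auto
    then show False using x b by (simp add: insert_absorb)
  qed
  then show ?thesis using x BE \<open>x \<notin> B\<close> by (auto simp: indep_def)
qed

text \<open>Steinitz exchange: elements of \<open>B\<close> outside \<open>C\<close> are replaced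
  one at a time by elements of \<open>C\<close>, keeping independence and cardinality, until
  \<open>B\<close> is a subset of \<open>C\<close>.\<close>

lemma card_indep_le:
  assumes "finite C" "C \<subseteq> E" "finite B" "indep B" "B \<subseteq> cl C"
  shows "card B \<le> card C"
  using assms(3-)
proof (induction "card (B - C)" arbitrary: B rule: less_induct)
  case less
  show ?case
  proof (cases "B \<subseteq> C")
    case True
    then show ?thesis using \<open>finite C\<close> by (simp add: card_mono)
  next
    case False
    then obtain b where b: "b \<in> B" "b \<notin> C" by auto
    have indep: "indep (B - {b})" using less.prems(2) by (rule indep_subset) auto
    then have sub: "B - {b} \<subseteq> E" by (simp add: indep_def)
    have "b \<notin> cl (B - {b})" using less.prems(2) b by (simp add: indep_def)
    moreover have "b \<in> cl C" using less.prems b by auto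
    \<comment> \<open>If all of \<open>C\<close> lay in \<open>cl (B - {b})\<close>, then so would
      \<open>cl C\<close>, and with it \<open>b\<close>.\<close>
    ultimately obtain c where c: "c \<in> C" "c \<notin> cl (B - {b})"
      using cl_least[OF sub, of C] by blast
    then have c': "c \<notin> B - {b}" using subset_cl[OF sub] by auto
    let ?B = "insert c (B - {b})"
    have "?B - C \<subset> B - C" using b c by auto
    then have "card (?B - C) < card (B - C)"
      using less.prems(1) by (intro psubset_card_mono) auto
    moreover have "indep ?B" using indep_insert[OF indep] c assms(2) by auto
    moreover have "?B \<subseteq> cl C" using c subset_cl[OF assms(2)] less.prems(3) by auto
    ultimately have "card ?B \<le> card C"
      using less.prems(1) by (intro less.hyps) simp_all
    \<comment> \<open>By \<open>c'\<close> the element \<open>c\<close> is genuinely new, so the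
      swap neither gains nor loses an element.\<close>
    moreover have "card ?B = card B"
      using b c' less.prems(1) by (simp add: card_Suc_Diff1 del: card_Diff_insert)
    ultimately show ?thesis by simp
  qed
qed

text \<open>An infinite \<open>B\<close> would contain an independent subset with one element more
  than \<open>C\<close>.\<close>

lemma indep_finite:
  assumes "finite C" "C \<subseteq> E" "indep B" "B \<subseteq> cl C"
  shows "finite B"
proof (rule ccontr)
  assume "infinite B"
  then obtain A where "finite A" "card A = Suc (card C)" "A \<subseteq> B"
    using infinite_arbitrarily_large by blast
  then show False
    using card_indep_le[of C A] indep_subset[of B A] assms by auto
qed

text \<open>For infinite \<open>C\<close> exchange is replaced by counting: each element of
  \<open>C\<close> depends on finitely many elements of \<open>B\<close>, and the union of these
  finite sets already exhausts \<open>B\<close>, so \<open>B\<close> is a union of finite sets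
  indexed by \<open>C\<close>.\<close>

lemma basis_lepoll:
  includes cardinal_syntax
  assumes B: "indep B" "B \<subseteq> cl C" and C: "C \<subseteq> E" "C \<subseteq> cl B"
  shows "B \<lesssim> C"
proof (cases "finite C")
  case True
  then show ?thesis
    using card_indep_le indep_finite assms by (simp add: lepoll_iff_card_le)
next
  case False
  have BE: "B \<subseteq> E" using B by (simp add: indep_def)
  then have "\<forall>c\<in>C. \<exists>F. finite F \<and> F \<subseteq> B \<and> c \<in> cl F"
    using finitary[of B] C by auto
  then obtain F where F: "\<And>c. c \<in> C \<Longrightarrow> finite (F c) \<and> F c \<subseteq> B \<and> c \<in> cl (F c)"
    by metis
  let ?U = "\<Union>c\<in>C. F c"
  have UB: "?U \<subseteq> B" using F by auto
  have "c \<in> cl ?U" if "c \<in> C" for c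
    using F[OF that] cl_mono[of "F c" ?U] UB BE that by blast
  then have "cl C \<subseteq> cl ?U"
    using UB BE by (intro cl_least) auto
  then have "b \<in> cl ?U" if "b \<in> B" for b
    using that B by blast
  \<comment> \<open>Such a \<open>b\<close> leaves \<open>?U\<close> inside \<open>B - {b}\<close>,
    whose closure misses \<open>b\<close> by independence.\<close>
  moreover have "b \<notin> cl ?U" if "b \<in> B" "b \<notin> ?U" for b
    using that B cl_mono[of ?U "B - {b}"] UB BE unfolding indep_def by blast
  ultimately have "B = ?U" using UB by blast
  have "|F c| \<le>o |C|" if "c \<in> C" for c
    using F[OF that] finite_lepoll_infinite[OF False]
    by (auto simp: lepoll_def simp flip: card_of_ordLeq)
  then have "|?U| \<le>o |C|"
    using False by (intro card_of_UNION_ordLeq_infinite[OF False card_of_mono1] ballI) auto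
  then show ?thesis
    using \<open>B = ?U\<close> by (simp add: lepoll_def card_of_ordLeq)
qed

theorem bases_eqpoll:
  assumes "indep B" "indep C" "B \<subseteq> cl C" "C \<subseteq> cl B"
  shows "B \<approx> C"
  using assms basis_lepoll by (intro lepoll_antisym) (auto simp: indep_def)

end

section \<open>Projections of internal direct sums\<close>

context abelian_group
begin

text \<open>Allows sums over different supports to be rewritten over one common finite index
  set.\<close>

lemma finsum_support:
  assumes "finite J" "{i \<in> I. f i \<noteq> \<zero>} \<subseteq> J" "J \<subseteq> I" "f \<in> I \<rightarrow> carrier G"
  shows "finsum G f {i \<in> I. f i \<noteq> \<zero>} = finsum G f J"
  using assms by (intro add.finprod_mono_neutral_cong_left) auto

text \<open>The map \<open>p\<close> is the coordinate at \<open>i\<close> of the unique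
  decomposition; each of its properties comes from exhibiting a decomposition and appealing to
  uniqueness.\<close>

lemma internal_direct_sum_projection:
  assumes ds: "internal_direct_sum G I N" and i: "i \<in> I"
  obtains p where "\<And>x. x \<in> carrier G \<Longrightarrow> p x \<in> N i"
    and "\<And>x y. \<lbrakk>x \<in> carrier G; y \<in> carrier G\<rbrakk> \<Longrightarrow> p (x \<oplus> y) = p x \<oplus> p y"
    and "\<And>x. x \<in> N i \<Longrightarrow> p x = x"
    and "\<And>j x. \<lbrakk>j \<in> I; j \<noteq> i; x \<in> N j\<rbrakk> \<Longrightarrow> p x = \<zero>"
proof -
  let ?P = "\<lambda>x f. f \<in> (\<Pi>\<^sub>E i\<in>I. N i) \<and> finite {i\<in>I. f i \<noteq> \<zero>} \<and>
        x = (\<Oplus>i\<in>{i\<in>I. f i \<noteq> \<zero>}. f i)"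
  define c where "c x = (THE f. ?P x f)" for x
  have grp: "additive_subgroup (N j) G" if "j \<in> I" for j
    using ds that by (simp add: internal_direct_sum_def)
  have N: "x \<in> carrier G" if "j \<in> I" "x \<in> N j" for j x
    using additive_subgroup.a_Hcarr[OF grp] that by blast
  have ex1: "\<exists>!f. ?P x f" if "x \<in> carrier G" for x
    using ds that by (simp add: internal_direct_sum_def)
  have c: "?P x (c x)" if "x \<in> carrier G" for x
    unfolding c_def by (rule theI'[OF ex1[OF that]])
  \<comment> \<open>Uniqueness in a convenient form: \<open>J\<close> may be larger than the
    support, and \<open>f\<close> need not be extensional, since \<open>restrict\<close> repairs its
    values outside \<open>I\<close>.\<close>
  have c_eq: "c x = restrict f I"
    if f: "f \<in> (\<Pi> i\<in>I. N i)" and J: "finite J" "J \<subseteq> I" "{i\<in>I. f i \<noteq> \<zero>} \<subseteq> J"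
      and x: "x = (\<Oplus>i\<in>J. f i)" for x f J
  proof -
    have fc: "f \<in> I \<rightarrow> carrier G" using f N by blast
    have "{i \<in> I. restrict f I i \<noteq> \<zero>} = {i \<in> I. f i \<noteq> \<zero>}" by auto
    moreover have "(\<Oplus>i\<in>{i\<in>I. f i \<noteq> \<zero>}. restrict f I i) = (\<Oplus>i\<in>{i\<in>I. f i \<noteq> \<zero>}. f i)"
      using fc by (intro finsum_cong') auto
    moreover have "finite {i\<in>I. f i \<noteq> \<zero>}" using J finite_subset by blast
    ultimately have "?P x (restrict f I)"
      using f x finsum_support[OF J(1,3,2) fc] by auto
    moreover have "x \<in> carrier G" using x fc J by (auto intro!: finsum_closed)
    ultimately show ?thesis using ex1 c by blast
  qed
  have c_single: "c x = (\<lambda>k\<in>I. if k = j then x else \<zero>)" if "j \<in> I" "x \<in> N j" for j x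
    using that N additive_subgroup.zero_closed[OF grp]
    by (intro c_eq[where J = "{j}"]) (auto split: if_splits)
  show thesis
  proof
    show "c x i \<in> N i" if "x \<in> carrier G" for x
      using c[OF that] i by auto
    show "c (x \<oplus> y) i = c x i \<oplus> c y i" if xy: "x \<in> carrier G" "y \<in> carrier G" for x y
    proof -
      \<comment> \<open>Cancellation can make the support of the sum smaller than \<open>?J\<close>;
        \<open>c_eq\<close> only asks that \<open>?J\<close> contain it.\<close>
      let ?J = "{i\<in>I. c x i \<noteq> \<zero>} \<union> {i\<in>I. c y i \<noteq> \<zero>}"
      have J: "finite ?J" "?J \<subseteq> I" using c xy by auto
      have cx: "c x \<in> I \<rightarrow> carrier G" and cy: "c y \<in> I \<rightarrow> carrier G"
        using c xy N by (blast dest: PiE_mem)+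
      have "x = (\<Oplus>i\<in>?J. c x i)" "y = (\<Oplus>i\<in>?J. c y i)"
        using c[OF xy(1)] c[OF xy(2)] finsum_support[OF J(1) _ J(2)] cx cy by auto
      then have "x \<oplus> y = (\<Oplus>i\<in>?J. c x i) \<oplus> (\<Oplus>i\<in>?J. c y i)" by metis
      also have "\<dots> = (\<Oplus>i\<in>?J. c x i \<oplus> c y i)"
        using J cx cy by (intro finsum_addf[symmetric]) auto
      finally have "c (x \<oplus> y) = (\<lambda>i\<in>I. c x i \<oplus> c y i)"
        using J c[OF xy(1)] c[OF xy(2)] additive_subgroup.a_closed[OF grp]
        by (intro c_eq[where J = ?J]) (auto simp: PiE_mem)
      then show ?thesis using i by simp
    qed
    show "c x i = x" if "x \<in> N i" for x
      using c_single[OF i that] i by simp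
    show "c x i = \<zero>" if "j \<in> I" "j \<noteq> i" "x \<in> N j" for j x
      using c_single[of j x] that i by simp
  qed
qed

end

section \<open>Linear span\<close>

text \<open>Generators may recur in a derivation, so no coefficient functions have to be merged and
  the closure properties follow by rule induction.\<close>

inductive_set lspan ::
    "('r, 'p) ring_scheme \<Rightarrow> ('r, 'm, 'q) module_scheme \<Rightarrow> 'm set \<Rightarrow> 'm set"
  for R :: "('r, 'p) ring_scheme" and M :: "('r, 'm, 'q) module_scheme" and S :: "'m set" where
  lspan_zero: "\<zero>\<^bsub>M\<^esub> \<in> lspan R M S"
| lspan_step: "\<lbrakk>r \<in> carrier R; s \<in> S; m \<in> lspan R M S\<rbrakk> \<Longrightarrow> r \<odot>\<^bsub>M\<^esub> s \<oplus>\<^bsub>M\<^esub> m \<in> lspan R M S"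

lemma lspan_mono: "S \<subseteq> T \<Longrightarrow> lspan R M S \<subseteq> lspan R M T"
proof
  fix x assume "S \<subseteq> T" "x \<in> lspan R M S"
  from this(2,1) show "x \<in> lspan R M T"
    by induction (auto intro: lspan_zero lspan_step)
qed

lemma lspan_finitary:
  assumes "x \<in> lspan R M S"
  shows "\<exists>F. finite F \<and> F \<subseteq> S \<and> x \<in> lspan R M F"
  using assms
proof induction
  case lspan_zero
  then show ?case using lspan.lspan_zero by blast
next
  case (lspan_step r s m)
  then obtain F where "finite F" "F \<subseteq> S" "m \<in> lspan R M F" by auto
  moreover from this have "m \<in> lspan R M (insert s F)"
    using lspan_mono[of F "insert s F"] by blast
  ultimately show ?case
    using lspan_step by (intro exI[of _ "insert s F"]) (auto intro: lspan.lspan_step)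
qed

context left_module
begin

lemma smult_l_null [simp]: "x \<in> carrier M \<Longrightarrow> \<zero>\<^bsub>R\<^esub> \<odot>\<^bsub>M\<^esub> x = \<zero>\<^bsub>M\<^esub>"
  using smult_l_distr[of "\<zero>\<^bsub>R\<^esub>" "\<zero>\<^bsub>R\<^esub>" x] by (simp add: M.add.l_cancel_one)

lemma smult_r_null [simp]: "a \<in> carrier R \<Longrightarrow> a \<odot>\<^bsub>M\<^esub> \<zero>\<^bsub>M\<^esub> = \<zero>\<^bsub>M\<^esub>"
  using smult_r_distr[of a "\<zero>\<^bsub>M\<^esub>" "\<zero>\<^bsub>M\<^esub>"] by (simp add: M.add.l_cancel_one)

lemma smult_l_minus:
  assumes "a \<in> carrier R" "x \<in> carrier M"
  shows "(\<ominus>\<^bsub>R\<^esub> a) \<odot>\<^bsub>M\<^esub> x = \<ominus>\<^bsub>M\<^esub> (a \<odot>\<^bsub>M\<^esub> x)"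
  using smult_l_distr[of "\<ominus>\<^bsub>R\<^esub> a" a x] assms
  by (intro M.minus_equality[symmetric]) (auto simp: R.l_neg)

lemma lspan_carrier:
  assumes "x \<in> lspan R M S" "S \<subseteq> carrier M"
  shows "x \<in> carrier M"
  using assms by induction auto

lemma lspan_smult_base:
  assumes "S \<subseteq> carrier M" "r \<in> carrier R" "s \<in> S"
  shows "r \<odot>\<^bsub>M\<^esub> s \<in> lspan R M S"
proof -
  have "r \<odot>\<^bsub>M\<^esub> s \<oplus>\<^bsub>M\<^esub> \<zero>\<^bsub>M\<^esub> \<in> lspan R M S"
    using assms by (intro lspan_step lspan_zero)
  then show ?thesis using assms by (simp add: subsetD)
qed

lemma lspan_base:
  assumes "S \<subseteq> carrier M" "s \<in> S"
  shows "s \<in> lspan R M S"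
  using lspan_smult_base[OF assms(1) _ assms(2), of "\<one>\<^bsub>R\<^esub>"] assms by (simp add: subsetD)

lemma lspan_add:
  assumes "x \<in> lspan R M S" "y \<in> lspan R M S" "S \<subseteq> carrier M"
  shows "x \<oplus>\<^bsub>M\<^esub> y \<in> lspan R M S"
  using assms
proof induction
  case lspan_zero
  then show ?case by (simp add: lspan_carrier)
next
  case (lspan_step r s m)
  then have "r \<odot>\<^bsub>M\<^esub> s \<oplus>\<^bsub>M\<^esub> (m \<oplus>\<^bsub>M\<^esub> y) \<in> lspan R M S"
    by (intro lspan.lspan_step) auto
  moreover have "m \<in> carrier M" "y \<in> carrier M" "s \<in> carrier M"
    using lspan_step lspan_carrier by auto
  ultimately show ?case
    using lspan_step by (simp add: M.a_assoc)
qed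

lemma lspan_smult:
  assumes "x \<in> lspan R M S" "a \<in> carrier R" "S \<subseteq> carrier M"
  shows "a \<odot>\<^bsub>M\<^esub> x \<in> lspan R M S"
  using assms
proof induction
  case lspan_zero
  then show ?case by (simp add: lspan.lspan_zero)
next
  case (lspan_step r s m)
  then have "(a \<otimes>\<^bsub>R\<^esub> r) \<odot>\<^bsub>M\<^esub> s \<oplus>\<^bsub>M\<^esub> a \<odot>\<^bsub>M\<^esub> m \<in> lspan R M S"
    by (intro lspan.lspan_step) auto
  moreover have "m \<in> carrier M" "s \<in> carrier M"
    using lspan_step lspan_carrier by auto
  ultimately show ?case
    using lspan_step by (simp add: smult_r_distr smult_assoc)
qed

lemma lspan_least:
  assumes "T \<subseteq> lspan R M S" "S \<subseteq> carrier M"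
  shows "lspan R M T \<subseteq> lspan R M S"
proof
  fix x assume "x \<in> lspan R M T"
  then show "x \<in> lspan R M S"
    using assms by induction (auto intro: lspan_zero lspan_add lspan_smult)
qed

section \<open>Finite linear combinations and the inductive span\<close>

lemma lspan_finsum:
  assumes "finite A" "A \<subseteq> S" "c \<in> A \<rightarrow> carrier R" "S \<subseteq> carrier M"
  shows "(\<Oplus>\<^bsub>M\<^esub>b\<in>A. c b \<odot>\<^bsub>M\<^esub> b) \<in> lspan R M S"
  using assms
proof (induction A)
  case empty
  then show ?case by (simp add: lspan_zero)
next
  case (insert a A)
  then have "(\<Oplus>\<^bsub>M\<^esub>b\<in>insert a A. c b \<odot>\<^bsub>M\<^esub> b) = c a \<odot>\<^bsub>M\<^esub> a \<oplus>\<^bsub>M\<^esub> (\<Oplus>\<^bsub>M\<^esub>b\<in>A. c b \<odot>\<^bsub>M\<^esub> b)"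
    by (intro M.finsum_insert) auto
  with insert show ?case by (auto intro: lspan_step)
qed

lemma spanning_imp_lspan:
  assumes "spanning R M B" "B \<subseteq> carrier M"
  shows "carrier M \<subseteq> lspan R M B"
proof
  fix x assume "x \<in> carrier M"
  then obtain A c where "finite A" "A \<subseteq> B" "c \<in> A \<rightarrow> carrier R" "x = (\<Oplus>\<^bsub>M\<^esub>b\<in>A. c b \<odot>\<^bsub>M\<^esub> b)"
    using assms(1) by (auto simp: spanning_def)
  then show "x \<in> lspan R M B" using lspan_finsum assms(2) by simp
qed

text \<open>Here recurring generators must be merged: a new multiple of \<open>s\<close> is added to
  the coefficient that \<open>s\<close> already has.\<close>

lemma lspan_imp_finsum:
  assumes "x \<in> lspan R M S" "S \<subseteq> carrier M"
  obtains A c where "finite A" "A \<subseteq> S" "c \<in> A \<rightarrow> carrier R" "x = (\<Oplus>\<^bsub>M\<^esub>b\<in>A. c b \<odot>\<^bsub>M\<^esub> b)"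
proof -
  have "\<exists>A c. finite A \<and> A \<subseteq> S \<and> c \<in> A \<rightarrow> carrier R \<and> x = (\<Oplus>\<^bsub>M\<^esub>b\<in>A. c b \<odot>\<^bsub>M\<^esub> b)"
    using assms
  proof induction
    case lspan_zero
    show ?case by (intro exI[of _ "{}"]) auto
  next
    case (lspan_step r s m)
    then obtain A c where A: "finite A" "A \<subseteq> S" "c \<in> A \<rightarrow> carrier R"
      and m: "m = (\<Oplus>\<^bsub>M\<^esub>b\<in>A. c b \<odot>\<^bsub>M\<^esub> b)" by auto
    \<comment> \<open>The coefficient of \<open>s\<close> in \<open>m\<close>, with default zero, so
      that old and new generators are treated alike from \<open>m'\<close> on.\<close>
    let ?k = "if s \<in> A then c s else \<zero>\<^bsub>R\<^esub>"
    let ?rest = "\<Oplus>\<^bsub>M\<^esub>b\<in>A - {s}. c b \<odot>\<^bsub>M\<^esub> b"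
    have s: "s \<in> carrier M" and k: "?k \<in> carrier R" using lspan_step A by auto
    have cA: "c b \<odot>\<^bsub>M\<^esub> b \<in> carrier M" if "b \<in> A" for b
      using that A lspan_step by auto
    then have rest: "?rest \<in> carrier M" by auto
    have m': "m = ?k \<odot>\<^bsub>M\<^esub> s \<oplus>\<^bsub>M\<^esub> ?rest"
    proof (cases "s \<in> A")
      case True
      then have "(\<Oplus>\<^bsub>M\<^esub>b\<in>insert s (A - {s}). c b \<odot>\<^bsub>M\<^esub> b) = c s \<odot>\<^bsub>M\<^esub> s \<oplus>\<^bsub>M\<^esub> ?rest"
        using A cA by (intro M.finsum_insert) auto
      then show ?thesis using True m by (simp add: insert_absorb)
    next
      case False
      then show ?thesis using m s rest by simp
    qed
    let ?c = "c(s := r \<oplus>\<^bsub>R\<^esub> ?k)"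
    have "(\<Oplus>\<^bsub>M\<^esub>b\<in>insert s (A - {s}). ?c b \<odot>\<^bsub>M\<^esub> b) =
        ?c s \<odot>\<^bsub>M\<^esub> s \<oplus>\<^bsub>M\<^esub> (\<Oplus>\<^bsub>M\<^esub>b\<in>A - {s}. ?c b \<odot>\<^bsub>M\<^esub> b)"
      using A cA s k lspan_step by (intro M.finsum_insert) auto
    also have "(\<Oplus>\<^bsub>M\<^esub>b\<in>A - {s}. ?c b \<odot>\<^bsub>M\<^esub> b) = ?rest"
      using cA by (intro M.finsum_cong') auto
    also have "?c s \<odot>\<^bsub>M\<^esub> s \<oplus>\<^bsub>M\<^esub> ?rest = r \<odot>\<^bsub>M\<^esub> s \<oplus>\<^bsub>M\<^esub> m"
      unfolding m' using s k rest lspan_step.hyps(1) by (simp add: smult_l_distr M.a_assoc)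
    finally have "r \<odot>\<^bsub>M\<^esub> s \<oplus>\<^bsub>M\<^esub> m = (\<Oplus>\<^bsub>M\<^esub>b\<in>insert s (A - {s}). ?c b \<odot>\<^bsub>M\<^esub> b)" by simp
    moreover have "?c \<in> insert s (A - {s}) \<rightarrow> carrier R"
      using A k lspan_step.hyps(1) by auto
    ultimately show ?case
      using A lspan_step.hyps(2) by (intro exI[of _ "insert s (A - {s})"] exI[of _ ?c]) auto
  qed
  then show thesis using that by auto
qed

text \<open>Moving \<open>b\<close> to the other side of such a combination gives a relation in
  which \<open>b\<close> has coefficient -1; independence forces -1 = 0, which \<open>ne\<close>
  excludes.\<close>

lemma lin_independent_imp_notin_lspan:
  assumes indep: "lin_independent R M B" and B: "B \<subseteq> carrier M" "b \<in> B"
    and ne: "\<one>\<^bsub>R\<^esub> \<noteq> \<zero>\<^bsub>R\<^esub>"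
  shows "b \<notin> lspan R M (B - {b})"
proof
  assume "b \<in> lspan R M (B - {b})"
  then obtain A c where A: "finite A" "A \<subseteq> B - {b}" "c \<in> A \<rightarrow> carrier R"
    and b: "b = (\<Oplus>\<^bsub>M\<^esub>a\<in>A. c a \<odot>\<^bsub>M\<^esub> a)"
    using B by (auto elim: lspan_imp_finsum)
  let ?c = "c(b := \<ominus>\<^bsub>R\<^esub> \<one>\<^bsub>R\<^esub>)"
  have bM: "b \<in> carrier M" using B by auto
  have cA: "c a \<odot>\<^bsub>M\<^esub> a \<in> carrier M" if "a \<in> A" for a
    using that A B by auto
  have "(\<Oplus>\<^bsub>M\<^esub>a\<in>insert b A. ?c a \<odot>\<^bsub>M\<^esub> a) = ?c b \<odot>\<^bsub>M\<^esub> b \<oplus>\<^bsub>M\<^esub> (\<Oplus>\<^bsub>M\<^esub>a\<in>A. ?c a \<odot>\<^bsub>M\<^esub> a)"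
    using A bM cA by (intro M.finsum_insert) auto
  also have "(\<Oplus>\<^bsub>M\<^esub>a\<in>A. ?c a \<odot>\<^bsub>M\<^esub> a) = (\<Oplus>\<^bsub>M\<^esub>a\<in>A. c a \<odot>\<^bsub>M\<^esub> a)"
    using A cA by (intro M.finsum_cong') auto
  also have "?c b \<odot>\<^bsub>M\<^esub> b \<oplus>\<^bsub>M\<^esub> \<dots> = \<zero>\<^bsub>M\<^esub>"
    using bM by (simp add: smult_l_minus M.l_neg flip: b)
  finally have "(\<Oplus>\<^bsub>M\<^esub>a\<in>insert b A. ?c a \<odot>\<^bsub>M\<^esub> a) = \<zero>\<^bsub>M\<^esub>" .
  moreover have "finite (insert b A)" "insert b A \<subseteq> B" "?c \<in> insert b A \<rightarrow> carrier R"
    using A B by auto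
  ultimately have "\<forall>a\<in>insert b A. ?c a = \<zero>\<^bsub>R\<^esub>"
    using indep unfolding lin_independent_def by blast
  then have "\<ominus>\<^bsub>R\<^esub> \<one>\<^bsub>R\<^esub> = \<zero>\<^bsub>R\<^esub>" by simp
  then show False using ne R.r_neg[of "\<one>\<^bsub>R\<^esub>"] by simp
qed

end

section \<open>Homogeneous elements over a graded division ring\<close>

locale graded_vector_space =
  free_action \<Gamma> \<Gamma>' \<phi> + graded_division_ring \<Gamma> R Rg + graded_module \<Gamma> R Rg \<Gamma>' \<phi> M Mg
  for \<Gamma> :: "('g, 'k) monoid_scheme" and R :: "('r, 'p) ring_scheme" and Rg :: "'g \<Rightarrow> 'r set"
    and \<Gamma>' :: "'l set" and \<phi> :: "'g \<Rightarrow> 'l \<Rightarrow> 'l" and M :: "('r, 'm, 'q) module_scheme"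
    and Mg :: "'l \<Rightarrow> 'm set"
begin

definition homogeneous :: "'m set" where
  "homogeneous = (\<Union>l\<in>\<Gamma>'. Mg l)"

text \<open>The possible coefficients carrying degree \<open>l\<close> to degree \<open>k\<close>.
  Zero is adjoined because there may be no group element with \<phi> \<gamma> l = k; for
  \<open>l\<close> in \<Gamma>', freeness makes the set either zero alone or a single component of
  \<open>R\<close>.\<close>

definition transporter :: "'l \<Rightarrow> 'l \<Rightarrow> 'r set" where
  "transporter l k = {\<zero>\<^bsub>R\<^esub>} \<union> (\<Union>\<gamma>\<in>{\<gamma> \<in> carrier \<Gamma>. \<phi> \<gamma> l = k}. Rg \<gamma>)"

lemma additive_subgroup_Rg: "\<gamma> \<in> carrier \<Gamma> \<Longrightarrow> additive_subgroup (Rg \<gamma>) R"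
  using ring_direct_sum by (simp add: internal_direct_sum_def)

lemma additive_subgroup_Mg: "l \<in> \<Gamma>' \<Longrightarrow> additive_subgroup (Mg l) M"
  using module_direct_sum by (simp add: internal_direct_sum_def)

lemma Rg_carrier: "\<lbrakk>\<gamma> \<in> carrier \<Gamma>; a \<in> Rg \<gamma>\<rbrakk> \<Longrightarrow> a \<in> carrier R"
  by (rule additive_subgroup.a_Hcarr[OF additive_subgroup_Rg])

lemma homogeneous_carrier: "homogeneous \<subseteq> carrier M"
  using additive_subgroup.a_Hcarr[OF additive_subgroup_Mg] by (auto simp: homogeneous_def)

lemma transporter_carrier: "a \<in> transporter l k \<Longrightarrow> a \<in> carrier R"
  using Rg_carrier by (auto simp: transporter_def)

text \<open>Freeness of the action enters here: two degrees that both carry \<open>l\<close> to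
  \<open>k\<close> coincide, so the sum stays in one component.\<close>

lemma transporter_add:
  assumes "l \<in> \<Gamma>'" "a \<in> transporter l k" "b \<in> transporter l k"
  shows "a \<oplus>\<^bsub>R\<^esub> b \<in> transporter l k"
proof -
  consider "a = \<zero>\<^bsub>R\<^esub>" | "b = \<zero>\<^bsub>R\<^esub>"
    | \<gamma> \<delta> where "\<gamma> \<in> carrier \<Gamma>" "\<phi> \<gamma> l = k" "a \<in> Rg \<gamma>" "\<delta> \<in> carrier \<Gamma>" "\<phi> \<delta> l = k" "b \<in> Rg \<delta>"
    using assms by (auto simp: transporter_def)
  then show ?thesis
  proof cases
    case 3
    then have "\<gamma> = \<delta>" using free assms(1) by simp
    with 3 have "a \<oplus>\<^bsub>R\<^esub> b \<in> Rg \<gamma>"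
      using additive_subgroup.a_closed[OF additive_subgroup_Rg] by simp
    with 3 show ?thesis by (auto simp: transporter_def)
  qed (use assms transporter_carrier in simp_all)
qed

lemma transporter_Units: "\<lbrakk>a \<in> transporter l k; a \<noteq> \<zero>\<^bsub>R\<^esub>\<rbrakk> \<Longrightarrow> a \<in> Units R"
  using homogeneous_invertible by (auto simp: transporter_def)

text \<open>The induction over the span concerns \<open>p m\<close> for every \<open>m\<close>,
  because the partial sums building up \<open>x\<close> need not be homogeneous. Only at the end is
  it specialised to \<open>x\<close>, which \<open>p\<close> fixes.\<close>

lemma homogeneous_coefficient:
  assumes x: "x \<in> Mg k" "k \<in> \<Gamma>'" and y: "y \<in> Mg l" "l \<in> \<Gamma>'" and S: "S \<subseteq> homogeneous"
    and span: "x \<in> lspan R M (insert y S)"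
  obtains a t where "a \<in> transporter l k" "t \<in> lspan R M S" "x = a \<odot>\<^bsub>M\<^esub> y \<oplus>\<^bsub>M\<^esub> t"
proof -
  obtain p where p_Mg: "\<And>x. x \<in> carrier M \<Longrightarrow> p x \<in> Mg k"
    and p_add: "\<And>x y. \<lbrakk>x \<in> carrier M; y \<in> carrier M\<rbrakk> \<Longrightarrow> p (x \<oplus>\<^bsub>M\<^esub> y) = p x \<oplus>\<^bsub>M\<^esub> p y"
    and p_id: "\<And>x. x \<in> Mg k \<Longrightarrow> p x = x"
    and p_zero: "\<And>j x. \<lbrakk>j \<in> \<Gamma>'; j \<noteq> k; x \<in> Mg j\<rbrakk> \<Longrightarrow> p x = \<zero>\<^bsub>M\<^esub>"
    using M.internal_direct_sum_projection[OF module_direct_sum x(2)] by blast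
  have p0: "p \<zero>\<^bsub>M\<^esub> = \<zero>\<^bsub>M\<^esub>"
    using p_id additive_subgroup.zero_closed[OF additive_subgroup_Mg[OF x(2)]] by blast
  have SM: "S \<subseteq> carrier M" and yM: "y \<in> carrier M"
    using S y homogeneous_carrier by (auto simp: homogeneous_def)
  \<comment> \<open>Split \<open>r\<close> into its homogeneous components; the projection keeps
    exactly those whose degree moves \<open>j\<close> to \<open>k\<close>.\<close>
  have p_smult: "\<exists>a\<in>transporter j k. p (r \<odot>\<^bsub>M\<^esub> z) = a \<odot>\<^bsub>M\<^esub> z"
    if r: "r \<in> carrier R" and z: "z \<in> Mg j" "j \<in> \<Gamma>'" for r z j
  proof -
    have zM: "z \<in> carrier M" using z homogeneous_carrier by (auto simp: homogeneous_def)
    obtain f where f: "f \<in> (\<Pi>\<^sub>E i\<in>carrier \<Gamma>. Rg i)" "finite {i\<in>carrier \<Gamma>. f i \<noteq> \<zero>\<^bsub>R\<^esub>}"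
      and rf: "r = (\<Oplus>\<^bsub>R\<^esub>i\<in>{i\<in>carrier \<Gamma>. f i \<noteq> \<zero>\<^bsub>R\<^esub>}. f i)"
      using ring_direct_sum r unfolding internal_direct_sum_def by blast
    have "\<exists>a\<in>transporter j k. p ((\<Oplus>\<^bsub>R\<^esub>i\<in>J. f i) \<odot>\<^bsub>M\<^esub> z) = a \<odot>\<^bsub>M\<^esub> z"
      if "finite J" "J \<subseteq> carrier \<Gamma>" for J
      using that
    proof (induction J)
      case empty
      show ?case using zM p0 by (intro bexI[of _ "\<zero>\<^bsub>R\<^esub>"]) (auto simp: transporter_def)
    next
      case (insert i J)
      then obtain a where a: "a \<in> transporter j k" "p ((\<Oplus>\<^bsub>R\<^esub>i\<in>J. f i) \<odot>\<^bsub>M\<^esub> z) = a \<odot>\<^bsub>M\<^esub> z"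
        by auto
      have i: "i \<in> carrier \<Gamma>" "f i \<in> Rg i" using insert f by auto
      have fR: "f i \<in> carrier R" if "i \<in> carrier \<Gamma>" for i
        using that f Rg_carrier by (blast dest: PiE_mem)
      have fz: "f i \<odot>\<^bsub>M\<^esub> z \<in> Mg (\<phi> i j)" using i z module_graded_smult by blast
      have ij: "\<phi> i j \<in> \<Gamma>'" using i z element_image by blast
      \<comment> \<open>What \<open>p\<close> leaves of the component of degree \<open>i\<close>:
        all of it or nothing.\<close>
      define b where "b = (if \<phi> i j = k then f i else \<zero>\<^bsub>R\<^esub>)"
      have b: "b \<in> transporter j k" using i by (auto simp: b_def transporter_def)
      have pb: "p (f i \<odot>\<^bsub>M\<^esub> z) = b \<odot>\<^bsub>M\<^esub> z"
        using fz ij zM p_id p_zero by (auto simp: b_def)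
      have sJ: "(\<Oplus>\<^bsub>R\<^esub>i\<in>J. f i) \<in> carrier R"
        using fR insert by (intro R.finsum_closed) auto
      have "(\<Oplus>\<^bsub>R\<^esub>i\<in>insert i J. f i) = f i \<oplus>\<^bsub>R\<^esub> (\<Oplus>\<^bsub>R\<^esub>i\<in>J. f i)"
        using fR insert by (intro R.finsum_insert) auto
      then have "p ((\<Oplus>\<^bsub>R\<^esub>i\<in>insert i J. f i) \<odot>\<^bsub>M\<^esub> z) = (b \<oplus>\<^bsub>R\<^esub> a) \<odot>\<^bsub>M\<^esub> z"
        using sJ fR i zM a pb b transporter_carrier
        by (simp add: smult_l_distr p_add)
      then show ?case using transporter_add[OF z(2) b a(1)] by blast
    qed
    then show ?thesis using f rf by blast
  qed
  have "\<exists>a\<in>transporter l k. \<exists>t\<in>lspan R M S. p m = a \<odot>\<^bsub>M\<^esub> y \<oplus>\<^bsub>M\<^esub> t"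
    if "m \<in> lspan R M (insert y S)" for m
    using that
  proof induction
    case lspan_zero
    show ?case
      using yM p0 by (intro bexI[of _ "\<zero>\<^bsub>R\<^esub>"] bexI[of _ "\<zero>\<^bsub>M\<^esub>"])
        (auto simp: transporter_def intro: lspan.lspan_zero)
  next
    case (lspan_step r s m)
    then obtain a t where a: "a \<in> transporter l k" and t: "t \<in> lspan R M S"
      and pm: "p m = a \<odot>\<^bsub>M\<^esub> y \<oplus>\<^bsub>M\<^esub> t" by auto
    \<comment> \<open>A generator outside \<open>S\<close> is \<open>y\<close>, and it must be given
      the degree \<open>l\<close> so that its coefficients can be collected in
      \<open>transporter l k\<close>. The choice matters when \<open>y\<close> is zero, which lies
      in every component.\<close>
    obtain j where s: "s \<in> Mg j" "j \<in> \<Gamma>'" and j: "s \<notin> S \<Longrightarrow> j = l"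
      using lspan_step y S by (cases "s \<in> S") (auto simp: homogeneous_def)
    obtain b where b: "b \<in> transporter j k" "p (r \<odot>\<^bsub>M\<^esub> s) = b \<odot>\<^bsub>M\<^esub> s"
      using p_smult[OF lspan_step.hyps(1) s] by auto
    have sM: "s \<in> carrier M" using s homogeneous_carrier by (auto simp: homogeneous_def)
    have mM: "m \<in> carrier M"
      using lspan_step.hyps(3) SM yM by (intro lspan_carrier[of m "insert y S"]) auto
    have tM: "t \<in> carrier M" using t SM by (rule lspan_carrier)
    have aR: "a \<in> carrier R" and bR: "b \<in> carrier R"
      using a b transporter_carrier by auto
    have eq: "p (r \<odot>\<^bsub>M\<^esub> s \<oplus>\<^bsub>M\<^esub> m) = b \<odot>\<^bsub>M\<^esub> s \<oplus>\<^bsub>M\<^esub> (a \<odot>\<^bsub>M\<^esub> y \<oplus>\<^bsub>M\<^esub> t)"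
      using p_add lspan_step.hyps(1) sM mM b pm by simp
    show ?case
    proof (cases "s \<in> S")
      case True
      have "p (r \<odot>\<^bsub>M\<^esub> s \<oplus>\<^bsub>M\<^esub> m) = a \<odot>\<^bsub>M\<^esub> y \<oplus>\<^bsub>M\<^esub> (b \<odot>\<^bsub>M\<^esub> s \<oplus>\<^bsub>M\<^esub> t)"
        unfolding eq using aR bR sM yM tM by (intro M.a_lcomm) auto
      then show ?thesis using a lspan.lspan_step[OF bR True t] by blast
    next
      case False
      then have s_eq: "s = y" and b': "b \<in> transporter l k"
        using lspan_step.hyps(2) b j by auto
      have "p (r \<odot>\<^bsub>M\<^esub> s \<oplus>\<^bsub>M\<^esub> m) = (b \<oplus>\<^bsub>R\<^esub> a) \<odot>\<^bsub>M\<^esub> y \<oplus>\<^bsub>M\<^esub> t"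
        unfolding eq[unfolded s_eq] s_eq using aR bR yM tM by (simp add: smult_l_distr M.a_assoc)
      then show ?thesis using t transporter_add[OF y(2) b' a] by blast
    qed
  qed
  then show thesis using that span p_id[OF x(1)] by metis
qed

text \<open>The coefficient \<open>a\<close> of \<open>y\<close> is nonzero, since otherwise
  \<open>x\<close> would equal \<open>t\<close> and lie in the span of \<open>S\<close>. Being in a
  transporter it is then a unit, and the equation can be solved for \<open>y\<close>.\<close>

lemma homogeneous_exchange:
  assumes S: "S \<subseteq> homogeneous" and x: "x \<in> homogeneous" and y: "y \<in> homogeneous"
    and span: "x \<in> lspan R M (insert y S)" and nspan: "x \<notin> lspan R M S"
  shows "y \<in> lspan R M (insert x S)"
proof -
  obtain k l where k: "x \<in> Mg k" "k \<in> \<Gamma>'" and l: "y \<in> Mg l" "l \<in> \<Gamma>'"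
    using x y by (auto simp: homogeneous_def)
  obtain a t where a: "a \<in> transporter l k" and t: "t \<in> lspan R M S"
    and x_eq: "x = a \<odot>\<^bsub>M\<^esub> y \<oplus>\<^bsub>M\<^esub> t"
    using homogeneous_coefficient[OF k l S span] .
  have SM: "insert x S \<subseteq> carrier M" and yM: "y \<in> carrier M"
    using S x y homogeneous_carrier by auto
  have tM: "t \<in> carrier M" using t SM lspan_carrier by auto
  have "a \<noteq> \<zero>\<^bsub>R\<^esub>" using x_eq t nspan yM tM by auto
  then have "a \<in> Units R" using a transporter_Units by blast
  then obtain b where aR: "a \<in> carrier R" and b: "b \<in> carrier R" and ba: "b \<otimes>\<^bsub>R\<^esub> a = \<one>\<^bsub>R\<^esub>"
    by (auto simp: Units_def)
  have "b \<odot>\<^bsub>M\<^esub> x = y \<oplus>\<^bsub>M\<^esub> b \<odot>\<^bsub>M\<^esub> t"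
    using x_eq aR b yM tM smult_assoc[OF b aR yM] by (simp add: smult_r_distr ba)
  then have "y = b \<odot>\<^bsub>M\<^esub> x \<oplus>\<^bsub>M\<^esub> (\<ominus>\<^bsub>R\<^esub> b) \<odot>\<^bsub>M\<^esub> t"
    using b yM tM by (simp add: smult_l_minus M.a_assoc M.r_neg)
  moreover have "t \<in> lspan R M (insert x S)" using t lspan_mono[of S "insert x S"] by blast
  ultimately show ?thesis
    using b SM lspan_step[of b R x "insert x S" "(\<ominus>\<^bsub>R\<^esub> b) \<odot>\<^bsub>M\<^esub> t" M]
      lspan_smult[of t "insert x S" "\<ominus>\<^bsub>R\<^esub> b"] by auto
qed

text \<open>Only exchange draws on the division property and on freeness; the other axioms hold for
  spans of subsets of any left module.\<close>

sublocale homogeneous: finitary_matroid homogeneous "lspan R M"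
proof
  fix S T x y
  assume "S \<subseteq> homogeneous"
  then have S: "S \<subseteq> carrier M" using homogeneous_carrier by blast
  show "S \<subseteq> lspan R M S" using S lspan_base by blast
  show "lspan R M T \<subseteq> lspan R M S" if "T \<subseteq> lspan R M S"
    using that S by (rule lspan_least)
qed (blast intro: lspan_finitary homogeneous_exchange)+

section \<open>Homogeneous bases as bases of the matroid\<close>

lemma homogeneous_basis_indep:
  assumes "homogeneous_basis R \<Gamma>' M Mg B"
  shows "homogeneous.indep B"
  using assms lin_independent_imp_notin_lspan one_not_zero
  unfolding homogeneous_basis_def module_basis_def homogeneous.indep_def homogeneous_def[symmetric]
  by blast

lemma homogeneous_basis_lspan:
  assumes "homogeneous_basis R \<Gamma>' M Mg B"
  shows "carrier M \<subseteq> lspan R M B"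
  using assms spanning_imp_lspan by (simp add: homogeneous_basis_def module_basis_def)

end

theorem proposition4p2p5:
  fixes \<Gamma> :: "('g, 'k) monoid_scheme" and \<Gamma>' :: "'l set" and \<phi> :: "'g \<Rightarrow> 'l \<Rightarrow> 'l"
    and R :: "('r, 'p) ring_scheme" and Rg :: "'g \<Rightarrow> 'r set"
    and M :: "('r, 'm, 'q) module_scheme" and Mg :: "'l \<Rightarrow> 'm set"
    and B C :: "'m set"
  assumes "free_action \<Gamma> \<Gamma>' \<phi>"
    and "graded_division_ring \<Gamma> R Rg"
    and "graded_module \<Gamma> R Rg \<Gamma>' \<phi> M Mg"
    and "homogeneous_basis R \<Gamma>' M Mg B"
    and "homogeneous_basis R \<Gamma>' M Mg C"
  shows "B \<approx> C"
proof -
  interpret graded_vector_space \<Gamma> R Rg \<Gamma>' \<phi> M Mg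
    using assms(1-3) by (rule graded_vector_space.intro)
  have "B \<subseteq> carrier M" "C \<subseteq> carrier M"
    using assms(4,5) by (auto simp: homogeneous_basis_def module_basis_def)
  \<comment> \<open>Each basis spans all of \<open>carrier M\<close>, hence contains the other basis
    in its closure.\<close>
  then show ?thesis
    using homogeneous_basis_indep[OF assms(4)] homogeneous_basis_lspan[OF assms(4)]
      homogeneous_basis_indep[OF assms(5)] homogeneous_basis_lspan[OF assms(5)]
    by (intro homogeneous.bases_eqpoll) auto
qed

end
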